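(* Given a connected split graph $G=(K\cup I,E)$ with at least two vertices, where $K$ is a clique and $I$ is an independent set partitioning the vertex set, the following algorithm computes the independent Roman domination number $i_R(G)$ in linear time. Algorithm. Input: the split graph $G=(K\cup I,E)$. Set $Max\leftarrow 0$ and $v_{highest\_degree}\leftarrow\bot$. For each $x\in K$: if $\deg_I(x)>Max$, set $Max\leftarrow \deg_I(x)$ and $v_{highest\_degree}\leftarrow x$. Then set $i(G)\leftarrow |I|-Max+1$, set $i_R(G)\leftarrow i(G)+1$, and return $i_R(G)$.
   Context: All graphs are finite, simple and undirected. A graph is a split graph if its vertex set can be partitioned into a clique and an independent set. For $x\in K$, $\deg_I(x)$ denotes the number of neighbours of $x$ in $I$. The independent domination number $i(G)$ is the minimum cardinality of a set of vertices that is both independent and dominating (every vertex outside the set has a neighbour in it). For a graph $G=(V,E)$, an independent Roman dominating function (IRDF) of $G$ is a function $f:V\to\{0,1,2\}$ such that (i) every $v\in V$ with $f(v)=0$ has a neighbour $u$ with $f(u)=2$, and (ii) the set $\{v\in V: f(v)\in\{1,2\}\}$ is independent. Its weight is $w(f)=\sum_{v\in V}f(v)$, and $i_R(G)=\min\{w(f): f \text{ is an IRDF of } G\}$. *)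

theory Defs
  imports Main
begin

section \<open>Graphs\<close>

text \<open>A graph is given by its vertex set and its set of edges, an edge being the two-element set of
  its end points.\<close>

definition simple_graph :: "'a set \<Rightarrow> 'a set set \<Rightarrow> bool" where
  "simple_graph V E \<longleftrightarrow> finite V \<and> (\<forall>e\<in>E. e \<subseteq> V \<and> card e = 2)"

definition neighbours :: "'a set set \<Rightarrow> 'a \<Rightarrow> 'a set" where
  "neighbours E v = {u. {v, u} \<in> E}"

definition connected_graph :: "'a set \<Rightarrow> 'a set set \<Rightarrow> bool" where
  "connected_graph V E \<longleftrightarrow> V \<noteq> {} \<and> (\<forall>u\<in>V. \<forall>v\<in>V. (u, v) \<in> {(x, y). {x, y} \<in> E}\<^sup>*)"

definition clique :: "'a set set \<Rightarrow> 'a set \<Rightarrow> bool" where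
  "clique E S \<longleftrightarrow> (\<forall>u\<in>S. \<forall>v\<in>S. u \<noteq> v \<longrightarrow> {u, v} \<in> E)"

definition independent_set :: "'a set set \<Rightarrow> 'a set \<Rightarrow> bool" where
  "independent_set E S \<longleftrightarrow> (\<forall>u\<in>S. \<forall>v\<in>S. {u, v} \<notin> E)"

definition split_partition :: "'a set \<Rightarrow> 'a set set \<Rightarrow> 'a set \<Rightarrow> 'a set \<Rightarrow> bool" where
  "split_partition V E K I \<longleftrightarrow>
     V = K \<union> I \<and> K \<inter> I = {} \<and> clique E K \<and> independent_set E I"

definition irdf :: "'a set \<Rightarrow> 'a set set \<Rightarrow> ('a \<Rightarrow> nat) \<Rightarrow> bool" where
  "irdf V E f \<longleftrightarrow>
     (\<forall>v\<in>V. f v \<in> {0, 1, 2}) \<and>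
     (\<forall>v\<in>V. f v = 0 \<longrightarrow> (\<exists>u\<in>V. u \<in> neighbours E v \<and> f u = 2)) \<and>
     independent_set E {v \<in> V. f v \<in> {1, 2}}"

definition weight :: "'a set \<Rightarrow> ('a \<Rightarrow> nat) \<Rightarrow> nat" where
  "weight V f = (\<Sum>v\<in>V. f v)"

definition ind_roman_dom_number :: "'a set \<Rightarrow> 'a set set \<Rightarrow> nat" where
  "ind_roman_dom_number V E = Min {weight V f |f. irdf V E f}"


section \<open>The machine model\<close>

text \<open>Running time is measured on a unit-cost random access machine, programmed in a small
  imperative language with scalar variables and arrays of natural numbers.  Every constant, variable
  access, array access, arithmetic operation, comparison, branch and assignment costs one step.  Addition
  and (truncated) subtraction are the only arithmetic operations.\<close>

record state =
  var :: "string \<Rightarrow> nat"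
  arr :: "string \<Rightarrow> nat \<Rightarrow> nat"

datatype aexp =
    N nat
  | X string
  | Get string aexp
  | Plus aexp aexp
  | Minus aexp aexp

datatype bexp = Less aexp aexp

datatype com =
    SKIP
  | Assign string aexp          ("_ ::= _" [1000, 61] 61)
  | Store string aexp aexp      ("_\<lbrakk>_\<rbrakk> ::= _" [1000, 0, 61] 61)
  | Seq com com                 ("_;;/ _" [60, 61] 60)
  | If bexp com com             ("(IF _/ THEN _/ ELSE _)" [0, 0, 61] 61)
  | While bexp com              ("(WHILE _/ DO _)" [0, 61] 61)

fun aval :: "aexp \<Rightarrow> state \<Rightarrow> nat" where
  "aval (N k) s = k"
| "aval (X x) s = var s x"
| "aval (Get a e) s = arr s a (aval e s)"
| "aval (Plus e1 e2) s = aval e1 s + aval e2 s"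
| "aval (Minus e1 e2) s = aval e1 s - aval e2 s"

fun acost :: "aexp \<Rightarrow> nat" where
  "acost (N k) = 1"
| "acost (X x) = 1"
| "acost (Get a e) = Suc (acost e)"
| "acost (Plus e1 e2) = Suc (acost e1 + acost e2)"
| "acost (Minus e1 e2) = Suc (acost e1 + acost e2)"

fun bval :: "bexp \<Rightarrow> state \<Rightarrow> bool" where
  "bval (Less e1 e2) s \<longleftrightarrow> aval e1 s < aval e2 s"

fun bcost :: "bexp \<Rightarrow> nat" where
  "bcost (Less e1 e2) = Suc (acost e1 + acost e2)"

definition set_var :: "string \<Rightarrow> nat \<Rightarrow> state \<Rightarrow> state" where
  "set_var x k s = s\<lparr>var := (var s)(x := k)\<rparr>"

definition set_arr :: "string \<Rightarrow> nat \<Rightarrow> nat \<Rightarrow> state \<Rightarrow> state" where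
  "set_arr a i k s = s\<lparr>arr := (arr s)(a := (arr s a)(i := k))\<rparr>"

text \<open>\<open>exec c s t s'\<close>: started in state \<open>s\<close>, the program \<open>c\<close> halts after \<open>t\<close> steps in state \<open>s'\<close>.\<close>

inductive exec :: "com \<Rightarrow> state \<Rightarrow> nat \<Rightarrow> state \<Rightarrow> bool" where
  exec_SKIP: "exec SKIP s 1 s"
| exec_Assign: "exec (x ::= e) s (acost e + 1) (set_var x (aval e s) s)"
| exec_Store: "exec (a\<lbrakk>i\<rbrakk> ::= e) s (acost i + acost e + 1) (set_arr a (aval i s) (aval e s) s)"
| exec_Seq: "exec c1 s t1 s1 \<Longrightarrow> exec c2 s1 t2 s2 \<Longrightarrow> exec (c1;; c2) s (t1 + t2) s2"
| exec_IfTrue: "bval b s \<Longrightarrow> exec c1 s t s' \<Longrightarrow> exec (IF b THEN c1 ELSE c2) s (bcost b + 1 + t) s'"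
| exec_IfFalse: "\<not> bval b s \<Longrightarrow> exec c2 s t s' \<Longrightarrow> exec (IF b THEN c1 ELSE c2) s (bcost b + 1 + t) s'"
| exec_WhileFalse: "\<not> bval b s \<Longrightarrow> exec (WHILE b DO c) s (bcost b + 1) s"
| exec_WhileTrue: "bval b s \<Longrightarrow> exec c s t1 s1 \<Longrightarrow> exec (WHILE b DO c) s1 t2 s2 \<Longrightarrow>
    exec (WHILE b DO c) s (bcost b + 1 + t1 + t2) s2"

inductive_cases exec_SKIP_E: "exec SKIP s t s'"
inductive_cases exec_Assign_E: "exec (x ::= e) s t s'"
inductive_cases exec_Store_E: "exec (a\<lbrakk>i\<rbrakk> ::= e) s t s'"
inductive_cases exec_Seq_E: "exec (c1;; c2) s t s'"
inductive_cases exec_If_E: "exec (IF b THEN c1 ELSE c2) s t s'"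
inductive_cases exec_While_E: "exec (WHILE b DO c) s t s'"

text \<open>The machine is deterministic, so exhibiting one halting run determines both the result and
  the running time.\<close>

lemma exec_deterministic:
  "exec c s t s' \<Longrightarrow> exec c s u s'' \<Longrightarrow> u = t \<and> s'' = s'"
proof (induction arbitrary: u s'' rule: exec.induct)
  case (exec_Seq c1 s t1 s1 c2 t2 s2)
  from exec_Seq.prems show ?case
    by (rule exec_Seq_E) (metis exec_Seq.IH)
next
  case (exec_WhileTrue b s c t1 s1 t2 s2)
  obtain t1' s1' t2' where u: "u = Suc (bcost b + t1' + t2')"
    and body: "exec c s t1' s1'" and rest: "exec (WHILE b DO c) s1' t2' s''"
    using exec_WhileTrue.prems by (rule exec_While_E) (metis exec_WhileTrue.hyps(1))+
  have "t1' = t1" and s1: "s1' = s1"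
    using exec_WhileTrue.IH(1)[OF body] by simp_all
  moreover have "t2' = t2 \<and> s'' = s2"
    using exec_WhileTrue.IH(2) rest unfolding s1 .
  ultimately show ?case
    using u by simp
next
  case (exec_WhileFalse b s c)
  from exec_WhileFalse.prems show ?case
    by (rule exec_While_E) (simp_all add: exec_WhileFalse.hyps)
next
  case (exec_IfTrue b s c1 t s' c2)
  from exec_IfTrue.prems show ?case
    by (rule exec_If_E) (use exec_IfTrue.hyps(1) exec_IfTrue.IH in auto)
next
  case (exec_IfFalse b s c2 t s' c1)
  from exec_IfFalse.prems show ?case
    by (rule exec_If_E) (use exec_IfFalse.hyps(1) exec_IfFalse.IH in auto)
qed (auto elim: exec_SKIP_E exec_Assign_E exec_Store_E)


section \<open>The input and the algorithm\<close>

text \<open>Adjacency-list representation of a graph together with a partition of its vertices.  The vertices are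
  numbered from \<open>0\<close> to \<open>n - 1\<close> by \<open>\<nu>\<close>, in no particular order; the arrays \<open>K\<close> and \<open>I\<close> list the
  numbers of the vertices of the two parts; and the neighbours of the vertex with number \<open>i\<close> are listed in
  the segment of the array \<open>nbr\<close> from position \<open>off[i]\<close> to position \<open>off[i + 1] - 1\<close>.  The initial contents
  of all other memory cells are arbitrary.\<close>

definition encodes ::
  "('a \<Rightarrow> nat) \<Rightarrow> state \<Rightarrow> 'a set \<Rightarrow> 'a set set \<Rightarrow> 'a set \<Rightarrow> 'a set \<Rightarrow> bool" where
  "encodes \<nu> s V E K I \<longleftrightarrow>
     bij_betw \<nu> V {0..<card V} \<and>
     var s ''n'' = card V \<and>
     var s ''nK'' = card K \<and> bij_betw (arr s ''K'') {0..<card K} (\<nu> ` K) \<and>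
     var s ''nI'' = card I \<and> bij_betw (arr s ''I'') {0..<card I} (\<nu> ` I) \<and>
     arr s ''off'' 0 = 0 \<and>
     (\<forall>i<card V. arr s ''off'' i \<le> arr s ''off'' (Suc i)) \<and>
     (\<forall>v\<in>V. bij_betw (arr s ''nbr'') {arr s ''off'' (\<nu> v)..<arr s ''off'' (Suc (\<nu> v))}
                (\<nu> ` neighbours E v))"

text \<open>Tabulates the indicator function of \<open>I\<close> in the array \<open>inI\<close>.\<close>

definition mark_I :: com where
  "mark_I =
     ''j'' ::= N 0;;
     WHILE Less (X ''j'') (X ''nK'') DO
       (''inI''\<lbrakk>Get ''K'' (X ''j'')\<rbrakk> ::= N 0;;
        ''j'' ::= Plus (X ''j'') (N 1));;
     ''j'' ::= N 0;;
     WHILE Less (X ''j'') (X ''nI'') DO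
       (''inI''\<lbrakk>Get ''I'' (X ''j'')\<rbrakk> ::= N 1;;
        ''j'' ::= Plus (X ''j'') (N 1))"

text \<open>Stores the number of neighbours in \<open>I\<close> of the vertex \<open>x\<close> in the variable \<open>deg_I\<close>.\<close>

definition compute_deg_I :: com where
  "compute_deg_I =
     ''deg_I'' ::= N 0;;
     ''p'' ::= Get ''off'' (X ''x'');;
     WHILE Less (X ''p'') (Get ''off'' (Plus (X ''x'') (N 1))) DO
       (''deg_I'' ::= Plus (X ''deg_I'') (Get ''inI'' (Get ''nbr'' (X ''p'')));;
        ''p'' ::= Plus (X ''p'') (N 1))"

text \<open>The value \<open>n\<close>, which is not the number of a vertex, plays the role of \<open>\<bottom>\<close>.  The names \<open>i(G)\<close> and
  \<open>i_R(G)\<close> are those of program variables.  On an encoded split graph all numbers computed by the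
  program are at most \<open>max (n + 1) (2 * card E)\<close>, so that the unit-cost measure is adequate.\<close>

definition ird_algorithm :: com where
  "ird_algorithm =
     mark_I;;
     ''Max'' ::= N 0;;
     ''v_highest_degree'' ::= X ''n'';;
     ''k'' ::= N 0;;
     WHILE Less (X ''k'') (X ''nK'') DO
       (''x'' ::= Get ''K'' (X ''k'');;
        compute_deg_I;;
        IF Less (X ''Max'') (X ''deg_I'')
          THEN (''Max'' ::= X ''deg_I'';; ''v_highest_degree'' ::= X ''x'')
          ELSE SKIP;;
        ''k'' ::= Plus (X ''k'') (N 1));;
     ''i(G)'' ::= Plus (Minus (X ''nI'') (X ''Max'')) (N 1);;
     ''i_R(G)'' ::= Plus (X ''i(G)'') (N 1)"

end

theory Submission
  imports Defs
begin

text \<open>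
  Write \<open>M\<close> for the largest number of neighbours in \<open>I\<close> of a vertex of \<open>K\<close>.  The program returns
  \<open>|I| - M + 2\<close>, so the mathematical content is \<open>i_R(G) = |I| - M + 2\<close>.

  Lower bound.  In an IRDF \<open>f\<close> the set \<open>S\<close> of vertices with positive value is independent and
  dominating.  Some vertex has value 2, for otherwise no vertex could have value 0 and the whole vertex
  set would be independent, which a connected graph with two vertices does not allow; hence
  \<open>w(f) \<ge> |S| + 1\<close>.  Moreover \<open>|S| \<ge> |I| - M + 1\<close> (lemma \<open>independent_dominating_card_ge\<close>): the clique
  \<open>K\<close> contains at most one vertex \<open>x\<close> of \<open>S\<close>.  If there is one, the vertices of \<open>I\<close> not adjacent to \<open>x\<close>
  can only be dominated by themselves, so \<open>S\<close> contains them and \<open>x\<close>.  If there is none, \<open>S\<close> contains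
  all of \<open>I\<close>, and \<open>M \<ge> 1\<close> because no vertex is isolated.

  Upper bound.  Let \<open>x \<in> K\<close> have \<open>M\<close> neighbours in \<open>I\<close>.  The value 2 at \<open>x\<close>, 1 at the vertices of \<open>I\<close>
  not adjacent to \<open>x\<close>, and 0 elsewhere is an IRDF of weight \<open>|I| - M + 2\<close>
  (lemma \<open>irdf_weight_attained\<close>).

  Running time.  Tabulating \<open>I\<close> takes \<open>O(|K| + |I|)\<close> steps.  The main loop visits each vertex of \<open>K\<close>
  once and scans its adjacency list; by the handshake lemma these lists have total length at most
  \<open>2 |E|\<close>.  The correctness and the time bound of each loop are proved together, by an invariant
  indexed by the number of iterations done (lemma \<open>runs_While\<close>).
\<close>

section \<open>Independent domination in split graphs\<close>

text \<open>The element 0 is inserted because the program starts its search for the maximum at 0; it also gives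
  the maximum a value when \<open>K\<close> is empty.\<close>

definition max_deg_I :: "'a set set \<Rightarrow> 'a set \<Rightarrow> 'a set \<Rightarrow> nat" where
  "max_deg_I E K I = Max (insert 0 ((\<lambda>x. card (neighbours E x \<inter> I)) ` K))"

lemma neighbours_sym: "u \<in> neighbours E v \<longleftrightarrow> v \<in> neighbours E u"
  by (simp add: neighbours_def insert_commute)

lemma neighbours_subset:
  assumes "simple_graph V E"
  shows "neighbours E v \<subseteq> V"
  using assms by (force simp: simple_graph_def neighbours_def)

lemma not_neighbour_self:
  assumes "simple_graph V E"
  shows "v \<notin> neighbours E v"
  using assms by (force simp: simple_graph_def neighbours_def)

lemma connected_graph_neighbour:
  assumes "connected_graph V E" "card V \<ge> 2" "v \<in> V"
  obtains u where "u \<in> neighbours E v"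
proof -
  have "V \<noteq> {v}"
    using assms(2) by auto
  then obtain w where "w \<in> V" "w \<noteq> v"
    using assms(3) by blast
  then have "(v, w) \<in> {(x, y). {x, y} \<in> E}\<^sup>*"
    using assms by (simp add: connected_graph_def)
  then show ?thesis
    using \<open>w \<noteq> v\<close> that by (cases rule: converse_rtranclE) (auto simp: neighbours_def)
qed

lemma split_partition_neighbours_I:
  assumes "simple_graph V E" "split_partition V E K I" "u \<in> I"
  shows "neighbours E u \<subseteq> K"
  using neighbours_subset[OF assms(1), of u] assms(2,3)
  by (auto simp: split_partition_def independent_set_def neighbours_def)

lemma card_neighbours_le_max_deg_I:
  assumes "finite K" "x \<in> K"
  shows "card (neighbours E x \<inter> I) \<le> max_deg_I E K I"
  using assms by (simp add: max_deg_I_def)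

text \<open>This is the lower bound for the independent domination number \<open>i(G)\<close>.  The two cases are whether or
  not \<open>S\<close> meets the clique.  In the second one \<open>|S| \<ge> |I|\<close>, and what is left to see is
  \<open>max_deg_I E K I \<ge> 1\<close>; this follows from a vertex of \<open>S\<close> having a neighbour.\<close>

lemma independent_dominating_card_ge:
  assumes G: "simple_graph V E" "connected_graph V E" "card V \<ge> 2"
    and split: "split_partition V E K I"
    and S: "S \<subseteq> V" "independent_set E S"
    and dom: "\<And>v. v \<in> V - S \<Longrightarrow> neighbours E v \<inter> S \<noteq> {}"
  shows "card I - max_deg_I E K I + 1 \<le> card S"
proof -
  have fin: "finite V" "finite K" "finite I" "finite S"
    using G split S by (auto simp: simple_graph_def split_partition_def intro: finite_subset)
  have I_dom: "neighbours E u \<inter> (S \<inter> K) \<noteq> {}" if "u \<in> I - S" for u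
    using dom[of u] split_partition_neighbours_I[OF G(1) split, of u] that split
    by (auto simp: split_partition_def)
  show ?thesis
  proof (cases "S \<inter> K = {}")
    case False
    then obtain x where x: "x \<in> S" "x \<in> K" by blast
    \<comment> \<open>Since \<open>K\<close> is a clique, \<open>x\<close> is the only vertex of \<open>S\<close> in \<open>K\<close>.\<close>
    have "S \<inter> K = {x}"
      using x S(2) split unfolding independent_set_def split_partition_def clique_def by blast
    then have "I - neighbours E x \<subseteq> S"
      using I_dom neighbours_sym[of x E] by fastforce
    moreover have "x \<notin> I"
      using x split by (auto simp: split_partition_def)
    ultimately have "card (insert x (I - neighbours E x)) \<le> card S"
      using x fin by (intro card_mono) auto
    moreover have "card (insert x (I - neighbours E x)) = card (I - neighbours E x) + 1"
      using fin \<open>x \<notin> I\<close> by simp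
    moreover have "card (I - neighbours E x) = card I - card (neighbours E x \<inter> I)"
      using fin by (simp add: card_Diff_subset_Int Int_commute)
    ultimately show ?thesis
      using card_neighbours_le_max_deg_I[OF fin(2) x(2), of E I] by simp
  next
    case True
    have "I \<subseteq> S"
      using I_dom True by auto
    then have "card I \<le> card S"
      using fin by (simp add: card_mono)
    obtain v where "v \<in> V"
      using G(2) by (auto simp: connected_graph_def)
    then have "S \<noteq> {}"
      using dom[of v] by auto
    then obtain u where u: "u \<in> S" "u \<in> I"
      using True S(1) split by (auto simp: split_partition_def)
    then obtain x where x: "x \<in> neighbours E u"
      using connected_graph_neighbour[OF G(2,3)] S(1) by blast
    then have "x \<in> K"
      using split_partition_neighbours_I[OF G(1) split u(2)] by blast
    have "card (neighbours E x \<inter> I) > 0"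
      using x u fin neighbours_sym[of x E u] by (auto simp: card_gt_0_iff)
    then have "max_deg_I E K I > 0"
      using card_neighbours_le_max_deg_I[OF fin(2) \<open>x \<in> K\<close>, of E I] by simp
    moreover have "card S > 0"
      using u fin by (auto simp: card_gt_0_iff)
    ultimately show ?thesis
      using \<open>card I \<le> card S\<close> by simp
  qed
qed

text \<open>Besides counting 1 for each vertex of the independent dominating set of positive values, the weight
  counts at least one further unit, for a vertex of value 2.\<close>

lemma irdf_weight_ge:
  assumes G: "simple_graph V E" "connected_graph V E" "card V \<ge> 2"
    and split: "split_partition V E K I"
    and f: "irdf V E f"
  shows "card I - max_deg_I E K I + 2 \<le> weight V f"
proof -
  define S where "S = {v \<in> V. f v \<in> {1, 2}}"
  have fin: "finite V"
    using G by (simp add: simple_graph_def)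
  have vals: "f v = 0 \<or> f v = 1 \<or> f v = 2" if "v \<in> V" for v
    using f that by (auto simp: irdf_def)
  have two: "\<exists>u\<in>V. u \<in> neighbours E v \<and> f u = 2" if "v \<in> V" "f v = 0" for v
    using f that by (simp add: irdf_def)
  have S: "S \<subseteq> V" "independent_set E S"
    using f by (auto simp: irdf_def S_def)
  have dom: "neighbours E v \<inter> S \<noteq> {}" if "v \<in> V - S" for v
    using two[of v] vals[of v] that by (auto simp: S_def)
  \<comment> \<open>Without a vertex of value 2 there would be none of value 0, so \<open>S\<close> would be all of \<open>V\<close>
    and the graph would have no edge.\<close>
  obtain w where w: "w \<in> V" "f w = 2"
  proof (rule ccontr)
    assume "\<not> thesis"
    then have "S = V"
      using two vals that by (fastforce simp: S_def)
    obtain v where "v \<in> V"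
      using G(2) by (auto simp: connected_graph_def)
    then obtain u where "u \<in> neighbours E v"
      using connected_graph_neighbour[OF G(2,3)] by blast
    then show False
      using S(2) \<open>v \<in> V\<close> neighbours_subset[OF G(1), of v]
      by (auto simp: \<open>S = V\<close> independent_set_def neighbours_def)
  qed
  have "card S + 1 = (\<Sum>v\<in>V. of_bool (v \<in> S) + of_bool (v = w))"
    using fin w(1) S(1) by (simp add: sum.distrib Int_absorb1)
  also have "\<dots> \<le> weight V f"
    unfolding weight_def
  proof (rule sum_mono)
    show "of_bool (v \<in> S) + of_bool (v = w) \<le> f v" if "v \<in> V" for v
      using vals[OF that] w that by (auto simp: S_def)
  qed
  finally show ?thesis
    using independent_dominating_card_ge[OF G split S dom] by simp
qed

text \<open>Spending 2 on a vertex \<open>x\<close> of the clique takes care of the rest of the clique and of all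
  neighbours of \<open>x\<close>; each other vertex of \<open>I\<close> pays 1 for itself.  The best \<open>x\<close> is one with the most
  neighbours in \<open>I\<close>.\<close>

lemma irdf_weight_attained:
  assumes G: "simple_graph V E" "connected_graph V E" "card V \<ge> 2"
    and split: "split_partition V E K I"
  obtains f where "irdf V E f" "weight V f = card I - max_deg_I E K I + 2"
proof -
  let ?d = "\<lambda>x. card (neighbours E x \<inter> I)"
  have fin: "finite V" "finite K" "finite I"
    using G split by (auto simp: simple_graph_def split_partition_def)
  have V: "V = K \<union> I" "K \<inter> I = {}"
    using split by (auto simp: split_partition_def)
  \<comment> \<open>If \<open>K\<close> were empty, no vertex could have a neighbour.\<close>
  have "K \<noteq> {}"
  proof
    assume "K = {}"
    obtain v where "v \<in> V"
      using G(2) by (auto simp: connected_graph_def)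
    then show False
      using connected_graph_neighbour[OF G(2,3)] split_partition_neighbours_I[OF G(1) split]
        V \<open>K = {}\<close> by blast
  qed
  then have "Max (?d ` K) \<in> ?d ` K"
    using fin by simp
  then obtain x where x: "x \<in> K" "?d x = Max (?d ` K)"
    by auto
  then have max: "max_deg_I E K I = ?d x"
    using fin \<open>K \<noteq> {}\<close> by (simp add: max_deg_I_def)
  \<comment> \<open>Indicator functions let the weight split into cardinalities.\<close>
  define f :: "'a \<Rightarrow> nat" where
    "f v = 2 * of_bool (v = x) + of_bool (v \<in> I - neighbours E x)" for v
  have "x \<notin> I"
    using x V by blast
  have "irdf V E f"
    unfolding irdf_def
  proof (intro conjI ballI impI)
    show "f v \<in> {0, 1, 2}" for v
      using \<open>x \<notin> I\<close> by (cases "v = x") (auto simp: f_def)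
  next
    fix v assume v: "v \<in> V" "f v = 0"
    then have "v \<noteq> x" "v \<in> K \<or> v \<in> neighbours E x"
      using V by (auto simp: f_def)
    then have "x \<in> neighbours E v"
      using split x neighbours_sym[of x E v]
      by (auto simp: split_partition_def clique_def neighbours_def)
    then show "\<exists>u\<in>V. u \<in> neighbours E v \<and> f u = 2"
      using x V \<open>x \<notin> I\<close> by (auto simp: f_def)
  next
    have "{v \<in> V. f v \<in> {1, 2}} = insert x (I - neighbours E x)"
      using x V \<open>x \<notin> I\<close> by (auto simp: f_def of_bool_def split: if_splits)
    moreover have "independent_set E (insert x (I - neighbours E x))"
      using split not_neighbour_self[OF G(1), of x]
      by (auto simp: split_partition_def independent_set_def neighbours_def insert_commute)
    ultimately show "independent_set E {v \<in> V. f v \<in> {1, 2}}"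
      by simp
  qed
  moreover have "weight V f = card I - max_deg_I E K I + 2"
  proof -
    have "weight V f = 2 * card (V \<inter> {x}) + card (V \<inter> (I - neighbours E x))"
      using fin by (simp add: weight_def f_def sum.distrib set_diff_eq flip: sum_distrib_left)
    also have "V \<inter> {x} = {x}"
      using x V by blast
    also have "V \<inter> (I - neighbours E x) = I - neighbours E x"
      using V by blast
    also have "card (I - neighbours E x) = card I - ?d x"
      using fin by (simp add: card_Diff_subset_Int Int_commute)
    finally show ?thesis
      by (simp add: max)
  qed
  ultimately show ?thesis
    by (rule that)
qed

lemma ind_roman_dom_number_split_graph:
  assumes "simple_graph V E" "connected_graph V E" "card V \<ge> 2" "split_partition V E K I"
  shows "ind_roman_dom_number V E = card I - max_deg_I E K I + 2"
  unfolding ind_roman_dom_number_def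
proof (rule Min_eqI)
  have "weight V f \<le> 2 * card V" if "irdf V E f" for f
    using sum_bounded_above[of V f 2] that by (force simp: irdf_def weight_def)
  then show "finite {weight V f |f. irdf V E f}"
    by (intro finite_subset[OF _ finite_atMost[of "2 * card V"]]) auto
  show "card I - max_deg_I E K I + 2 \<le> y" if "y \<in> {weight V f |f. irdf V E f}" for y
    using irdf_weight_ge[OF assms] that by blast
  show "card I - max_deg_I E K I + 2 \<in> {weight V f |f. irdf V E f}"
    using irdf_weight_attained[OF assms] by (metis (mono_tags, lifting) mem_Collect_eq)
qed


section \<open>Total correctness with time bounds\<close>

text \<open>The time is an upper bound and not the exact one, so that the two branches of a conditional can be
  joined.  Each rule for a construct of the language has a conclusion with an arbitrary
  postcondition, so that the bound of a program is computed by unification when the rules are applied.\<close>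

definition runs :: "com \<Rightarrow> state \<Rightarrow> nat \<Rightarrow> (state \<Rightarrow> bool) \<Rightarrow> bool" where
  "runs c s T Q \<longleftrightarrow> (\<exists>t s'. exec c s t s' \<and> t \<le> T \<and> Q s')"

lemma runs_mono:
  assumes "runs c s T Q" "T \<le> T'" "\<And>s'. Q s' \<Longrightarrow> Q' s'"
  shows "runs c s T' Q'"
  using assms unfolding runs_def by (meson order_trans)

lemma runs_SKIP: "Q s \<Longrightarrow> runs SKIP s 1 Q"
  unfolding runs_def using exec_SKIP by blast

lemma runs_Assign: "Q (set_var x (aval e s) s) \<Longrightarrow> runs (x ::= e) s (acost e + 1) Q"
  unfolding runs_def using exec_Assign by blast

lemma runs_Store:
  "Q (set_arr a (aval i s) (aval e s) s) \<Longrightarrow> runs (a\<lbrakk>i\<rbrakk> ::= e) s (acost i + acost e + 1) Q"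
  unfolding runs_def using exec_Store by blast

text \<open>The intermediate assertion is the correctness of the rest of the program, as in a computation of
  weakest preconditions.\<close>

lemma runs_Seq:
  assumes "runs c1 s T1 (\<lambda>s1. runs c2 s1 T2 Q)"
  shows "runs (c1;; c2) s (T1 + T2) Q"
  using assms unfolding runs_def by (meson exec_Seq add_mono)

lemma runs_If:
  assumes "bval b s \<Longrightarrow> runs c1 s T1 Q" "\<not> bval b s \<Longrightarrow> runs c2 s T2 Q"
  shows "runs (IF b THEN c1 ELSE c2) s (bcost b + 1 + max T1 T2) Q"
proof (cases "bval b s")
  case True
  then obtain t s' where "exec c1 s t s'" "t \<le> T1" "Q s'"
    using assms(1) by (auto simp: runs_def)
  then show ?thesis
    unfolding runs_def using exec_IfTrue[OF True] by (meson add_left_mono max.coboundedI1)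
next
  case False
  then obtain t s' where "exec c2 s t s'" "t \<le> T2" "Q s'"
    using assms(2) by (auto simp: runs_def)
  then show ?thesis
    unfolding runs_def using exec_IfFalse[OF False] by (meson add_left_mono max.coboundedI2)
qed

text \<open>The invariant carries the number of iterations done, which is known in advance to end at \<open>n\<close>; this
  gives termination, and the bound \<open>T i\<close> may depend on the iteration, which the amortized count of
  the adjacency lists needs.  One more evaluation of the guard ends the loop.\<close>

lemma runs_While:
  assumes step: "\<And>i s. i < n \<Longrightarrow> P i s \<Longrightarrow> bval b s \<and> runs c s (T i) (P (Suc i))"
    and exit: "\<And>s. P n s \<Longrightarrow> \<not> bval b s"
    and init: "P 0 s"
  shows "runs (WHILE b DO c) s ((\<Sum>i<n. bcost b + 1 + T i) + (bcost b + 1)) (P n)"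
proof -
  \<comment> \<open>The claim for the remaining iterations, by induction from \<open>n\<close> downwards.\<close>
  have "runs (WHILE b DO c) s ((\<Sum>i=m..<n. bcost b + 1 + T i) + (bcost b + 1)) (P n)"
    if "m \<le> n" "P m s" for m s
    using that
  proof (induction arbitrary: s rule: inc_induct)
    case base
    then show ?case
      using exec_WhileFalse[OF exit] by (auto simp: runs_def)
  next
    case (step m)
    then obtain t1 s1 where 1: "bval b s" "exec c s t1 s1" "t1 \<le> T m" "P (Suc m) s1"
      using assms(1)[of m s] by (auto simp: runs_def)
    obtain t2 s2 where 2: "exec (WHILE b DO c) s1 t2 s2" "P n s2"
      "t2 \<le> (\<Sum>i=Suc m..<n. bcost b + 1 + T i) + (bcost b + 1)"
      using step.IH[OF 1(4)] by (auto simp: runs_def)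
    have "bcost b + 1 + t1 + t2 \<le> (\<Sum>i=m..<n. bcost b + 1 + T i) + (bcost b + 1)"
      using 1(3) 2(3) \<open>m < n\<close> by (simp add: sum.atLeast_Suc_lessThan)
    then show ?case
      unfolding runs_def using exec_WhileTrue[OF 1(1,2) 2(1)] 2(2) by blast
  qed
  from this[of 0 s] init show ?thesis
    by (simp add: atLeast0LessThan)
qed

lemma var_set_var [simp]: "var (set_var x k s) = (var s)(x := k)"
  and arr_set_var [simp]: "arr (set_var x k s) = arr s"
  and var_set_arr [simp]: "var (set_arr a i k s) = var s"
  and arr_set_arr [simp]: "arr (set_arr a i k s) = (arr s)(a := (arr s a)(i := k))"
  by (simp_all add: set_var_def set_arr_def)


section \<open>The program\<close>

abbreviation fill_inI :: "string \<Rightarrow> string \<Rightarrow> nat \<Rightarrow> com" where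
  "fill_inI l nl b \<equiv> WHILE Less (X ''j'') (X nl) DO
     (''inI''\<lbrakk>Get l (X ''j'')\<rbrakk> ::= N b;; ''j'' ::= Plus (X ''j'') (N 1))"

text \<open>In the loops below the constants are read off the code: here the body costs 8 steps and the test of the
  guard, with the branch, 4.\<close>

lemma runs_fill_inI:
  assumes "l \<noteq> ''inI''" "nl \<noteq> ''j''" "var s ''j'' = 0"
  shows "runs (fill_inI l nl b) s (12 * var s nl + 4)
    (\<lambda>s'. (\<forall>y. y \<noteq> ''j'' \<longrightarrow> var s' y = var s y) \<and>
      arr s' = (arr s)(''inI'' :=
        (\<lambda>m. if m \<in> arr s l ` {..<var s nl} then b else arr s ''inI'' m)))"
proof -
  let ?P = "\<lambda>i s'. var s' ''j'' = i \<and> (\<forall>y. y \<noteq> ''j'' \<longrightarrow> var s' y = var s y) \<and>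
    arr s' = (arr s)(''inI'' := (\<lambda>m. if m \<in> arr s l ` {..<i} then b else arr s ''inI'' m))"
  show ?thesis
  proof (rule runs_mono, rule runs_While[where P = ?P and n = "var s nl" and T = "\<lambda>_. 8"])
    fix i and s' :: state
    assume i: "i < var s nl" "?P i s'"
    show "bval (Less (X ''j'') (X nl)) s' \<and>
      runs (''inI''\<lbrakk>Get l (X ''j'')\<rbrakk> ::= N b;; ''j'' ::= Plus (X ''j'') (N 1)) s' 8 (?P (Suc i))"
    proof
      show "bval (Less (X ''j'') (X nl)) s'"
        using i assms by simp
      show "runs (''inI''\<lbrakk>Get l (X ''j'')\<rbrakk> ::= N b;; ''j'' ::= Plus (X ''j'') (N 1)) s' 8
          (?P (Suc i))"
        by (rule runs_mono, rule runs_Seq, rule runs_Store, rule runs_Assign[where Q = "?P (Suc i)"])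
          (use i assms(1,2) in \<open>auto simp: lessThan_Suc fun_eq_iff\<close>)
    qed
  qed (use assms in \<open>auto\<close>)
qed

text \<open>The array \<open>inI\<close> has arbitrary contents at first, so only its values at the listed vertices are
  known.  A number listed in both \<open>K\<close> and \<open>I\<close> ends up with 1, since \<open>I\<close> is processed last.\<close>

lemma runs_mark_I:
  "runs mark_I s (12 * (var s ''nK'' + var s ''nI'') + 12)
     (\<lambda>s'. (\<forall>y. y \<noteq> ''j'' \<longrightarrow> var s' y = var s y) \<and>
           (\<forall>a. a \<noteq> ''inI'' \<longrightarrow> arr s' a = arr s a) \<and>
           (\<forall>m. m \<in> arr s ''K'' ` {..<var s ''nK''} \<union> arr s ''I'' ` {..<var s ''nI''} \<longrightarrow>
             arr s' ''inI'' m = of_bool (m \<in> arr s ''I'' ` {..<var s ''nI''})))"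
  (is "runs _ _ _ ?Q")
proof -
  let ?P = "\<lambda>s'. (\<forall>y. y \<noteq> ''j'' \<longrightarrow> var s' y = var s y) \<and>
    arr s' = (arr s)(''inI'' :=
      (\<lambda>m. if m \<in> arr s ''K'' ` {..<var s ''nK''} then 0 else arr s ''inI'' m))"
  have K: "runs (fill_inI ''K'' ''nK'' 0) (set_var ''j'' (aval (N 0) s) s)
      (12 * var s ''nK'' + 4) ?P"
    by (rule runs_mono, rule runs_fill_inI) (auto simp: fun_eq_iff)
  have I: "runs (fill_inI ''I'' ''nI'' 1) (set_var ''j'' (aval (N 0) s1) s1)
      (12 * var s ''nI'' + 4) ?Q" if "?P s1" for s1
    by (rule runs_mono, rule runs_fill_inI) (use that in auto)
  show ?thesis
    unfolding mark_I_def
    by (rule runs_mono, (rule runs_Seq)+, rule runs_Assign, rule runs_mono[OF K order_refl],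
        rule runs_Assign, rule I) auto
qed

lemma runs_compute_deg_I:
  fixes s
  defines "lo \<equiv> arr s ''off'' (var s ''x'')" and "hi \<equiv> arr s ''off'' (Suc (var s ''x''))"
  assumes "lo \<le> hi"
  shows "runs compute_deg_I s (17 * (hi - lo) + 12)
     (\<lambda>s'. arr s' = arr s \<and> (\<forall>y. y \<notin> {''deg_I'', ''p''} \<longrightarrow> var s' y = var s y) \<and>
           var s' ''deg_I'' = (\<Sum>q=lo..<hi. arr s ''inI'' (arr s ''nbr'' q)))"
    (is "runs _ _ _ ?Q")
proof -
  \<comment> \<open>The invariant after \<open>i\<close> neighbours; each costs 10 steps and 7 for the guard.\<close>
  let ?P = "\<lambda>i s'. arr s' = arr s \<and> (\<forall>y. y \<notin> {''deg_I'', ''p''} \<longrightarrow> var s' y = var s y) \<and>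
    var s' ''p'' = lo + i \<and>
    var s' ''deg_I'' = (\<Sum>q=lo..<lo + i. arr s ''inI'' (arr s ''nbr'' q))"
  have loop: "runs (WHILE Less (X ''p'') (Get ''off'' (Plus (X ''x'') (N 1))) DO
       (''deg_I'' ::= Plus (X ''deg_I'') (Get ''inI'' (Get ''nbr'' (X ''p'')));;
        ''p'' ::= Plus (X ''p'') (N 1))) s1 (17 * (hi - lo) + 7) ?Q" if "?P 0 s1" for s1
  proof (rule runs_mono, rule runs_While[where P = ?P and n = "hi - lo" and T = "\<lambda>_. 10"])
    fix i and s' :: state
    assume i: "i < hi - lo" "?P i s'"
    show "bval (Less (X ''p'') (Get ''off'' (Plus (X ''x'') (N 1)))) s' \<and>
      runs (''deg_I'' ::= Plus (X ''deg_I'') (Get ''inI'' (Get ''nbr'' (X ''p'')));;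
        ''p'' ::= Plus (X ''p'') (N 1)) s' 10 (?P (Suc i))"
    proof
      show "bval (Less (X ''p'') (Get ''off'' (Plus (X ''x'') (N 1)))) s'"
        using i by (simp add: hi_def)
      show "runs (''deg_I'' ::= Plus (X ''deg_I'') (Get ''inI'' (Get ''nbr'' (X ''p'')));;
        ''p'' ::= Plus (X ''p'') (N 1)) s' 10 (?P (Suc i))"
        by (rule runs_mono, rule runs_Seq, rule runs_Assign, rule runs_Assign[where Q = "?P (Suc i)"])
          (use i in auto)
    qed
  qed (use that assms(3) in \<open>auto simp: hi_def\<close>)
  show ?thesis
    unfolding compute_deg_I_def
    by (rule runs_mono, (rule runs_Seq)+, rule runs_Assign, rule runs_Assign, rule loop)
      (auto simp: lo_def)
qed

text \<open>A statement about numbers only: \<open>S\<close> is the set of the numbers of the vertices in \<open>I\<close>, and \<open>seg m\<close> is the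
  segment with the neighbours of \<open>m\<close>.  The assumption on neighbours says that the program reads the array
  \<open>inI\<close> only where \<^const>\<open>mark_I\<close> has set it.\<close>

lemma runs_ird_algorithm:
  fixes s :: state
  defines "S \<equiv> arr s ''I'' ` {..<var s ''nI''}"
    and "seg \<equiv> \<lambda>m. {arr s ''off'' m..<arr s ''off'' (Suc m)}"
  assumes mono: "\<And>j. j < var s ''nK'' \<Longrightarrow>
      arr s ''off'' (arr s ''K'' j) \<le> arr s ''off'' (Suc (arr s ''K'' j))"
    and nbr: "\<And>j. j < var s ''nK'' \<Longrightarrow> arr s ''nbr'' ` seg (arr s ''K'' j) \<subseteq>
      arr s ''K'' ` {..<var s ''nK''} \<union> S"
  shows "runs ird_algorithm s
    (43 * var s ''nK'' + 12 * var s ''nI'' + 17 * (\<Sum>j<var s ''nK''. card (seg (arr s ''K'' j))) + 34)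
    (\<lambda>s'. var s' ''i_R(G)'' = var s ''nI'' -
      Max (insert 0 ((\<lambda>m. \<Sum>q\<in>seg m. of_bool (arr s ''nbr'' q \<in> S)) `
        arr s ''K'' ` {..<var s ''nK''})) + 2)"
    (is "runs _ _ _ ?Q")
proof -
  let ?d = "\<lambda>m. \<Sum>q\<in>seg m. of_bool (arr s ''nbr'' q \<in> S) :: nat"
  define mx where "mx k = Max (insert 0 (?d ` arr s ''K'' ` {..<k}))" for k
  let ?M = "\<lambda>s'. (\<forall>y. y \<noteq> ''j'' \<longrightarrow> var s' y = var s y) \<and>
    (\<forall>a. a \<noteq> ''inI'' \<longrightarrow> arr s' a = arr s a) \<and>
    (\<forall>m. m \<in> arr s ''K'' ` {..<var s ''nK''} \<union> S \<longrightarrow> arr s' ''inI'' m = of_bool (m \<in> S))"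
  let ?P = "\<lambda>k s'. var s' ''nK'' = var s ''nK'' \<and> var s' ''nI'' = var s ''nI'' \<and>
    (\<forall>a. a \<noteq> ''inI'' \<longrightarrow> arr s' a = arr s a) \<and>
    (\<forall>m. m \<in> arr s ''K'' ` {..<var s ''nK''} \<union> S \<longrightarrow> arr s' ''inI'' m = of_bool (m \<in> S)) \<and>
    var s' ''k'' = k \<and> var s' ''Max'' = mx k"
  let ?body = "''x'' ::= Get ''K'' (X ''k'');;
        compute_deg_I;;
        IF Less (X ''Max'') (X ''deg_I'')
          THEN (''Max'' ::= X ''deg_I'';; ''v_highest_degree'' ::= X ''x'')
          ELSE SKIP;;
        ''k'' ::= Plus (X ''k'') (N 1)"
  have mark: "runs mark_I s (12 * (var s ''nK'' + var s ''nI'') + 12) ?M"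
    using runs_mark_I unfolding S_def .
  have mx_0: "mx 0 = 0" and mx_Suc: "mx (Suc k) = max (mx k) (?d (arr s ''K'' k))" for k
    by (simp_all add: mx_def lessThan_Suc insert_commute[of 0] max.commute)
  have body: "runs ?body s1 (17 * card (seg (arr s ''K'' k)) + 27) (?P (Suc k))"
    if k: "k < var s ''nK''" and P: "?P k s1" for k s1
  proof -
    let ?s = "set_var ''x'' (aval (Get ''K'' (X ''k'')) s1) s1"
    have x: "var ?s ''x'' = arr s ''K'' k" and off: "arr ?s ''off'' = arr s ''off''"
      using P by simp_all
    have "(\<Sum>q\<in>seg (arr s ''K'' k). arr ?s ''inI'' (arr ?s ''nbr'' q)) = ?d (arr s ''K'' k)"
      using P nbr[OF k] by (intro sum.cong) auto
    with runs_compute_deg_I[of ?s] mono[OF k]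
    have deg: "runs compute_deg_I ?s (17 * card (seg (arr s ''K'' k)) + 12)
      (\<lambda>s'. arr s' = arr ?s \<and> (\<forall>y. y \<notin> {''deg_I'', ''p''} \<longrightarrow> var s' y = var ?s y) \<and>
           var s' ''deg_I'' = ?d (arr s ''K'' k))"
      unfolding x off seg_def by simp
    show ?thesis
      by (rule runs_mono, (rule runs_Seq)+, rule runs_Assign, rule runs_mono[OF deg order_refl],
          rule runs_If, rule runs_Seq, rule runs_Assign, rule runs_Assign,
          rule runs_Assign[where Q = "?P (Suc k)"], use P in \<open>simp add: mx_Suc\<close>,
          rule runs_SKIP, rule runs_Assign[where Q = "?P (Suc k)"], use P in \<open>simp add: mx_Suc\<close>)
        simp_all
  qed
  have loop: "runs (WHILE Less (X ''k'') (X ''nK'') DO ?body) s1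
    (31 * var s ''nK'' + 17 * (\<Sum>j<var s ''nK''. card (seg (arr s ''K'' j))) + 4)
    (?P (var s ''nK''))" if "?P 0 s1" for s1
  proof (rule runs_mono, rule runs_While[where P = ?P and n = "var s ''nK''"])
    show "bval (Less (X ''k'') (X ''nK'')) s2 \<and>
      runs ?body s2 (17 * card (seg (arr s ''K'' i)) + 27) (?P (Suc i))"
      if "i < var s ''nK''" "?P i s2" for i s2
      using body[OF that] that by simp
    show "?P 0 s1"
      by (rule that)
  qed (simp_all add: sum.distrib sum_distrib_left)
  show ?thesis
    unfolding ird_algorithm_def
    by (rule runs_mono, (rule runs_Seq)+, rule runs_mono[OF mark order_refl],
        rule runs_Assign, rule runs_Assign, rule runs_Assign, rule runs_mono[OF loop order_refl],
        simp add: mx_0, rule runs_Assign, rule runs_Assign[where Q = ?Q])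
      (simp_all add: mx_def)
qed


section \<open>Encoded graphs\<close>

text \<open>One half of the handshake lemma: every edge has two end points, and different neighbours of \<open>v\<close> give
  different edges at \<open>v\<close>.\<close>

lemma sum_card_neighbours_le:
  assumes G: "simple_graph V E" and "A \<subseteq> V"
  shows "(\<Sum>v\<in>A. card (neighbours E v)) \<le> 2 * card E"
proof -
  have fin: "finite V" "finite E"
    using G by (auto simp: simple_graph_def intro: finite_subset[of E "Pow V"])
  have "card (neighbours E v) \<le> card {e \<in> E. v \<in> e}" for v
    by (rule card_inj_on_le[where f = "\<lambda>u. {v, u}"])
      (use fin in \<open>auto simp: neighbours_def inj_on_def doubleton_eq_iff\<close>)
  then have "(\<Sum>v\<in>A. card (neighbours E v)) \<le> (\<Sum>v\<in>A. card {e \<in> E. v \<in> e})"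
    by (rule sum_mono)
  also have "\<dots> \<le> (\<Sum>v\<in>V. card {e \<in> E. v \<in> e})"
    using fin assms by (intro sum_mono2) auto
  also have "\<dots> = 2 * card E"
  proof (rule sum_multicount[OF fin], rule ballI)
    show "card {v \<in> V. v \<in> e} = 2" if "e \<in> E" for e
      using G that by (simp add: simple_graph_def Int_absorb1 flip: Int_def)
  qed
  finally show ?thesis .
qed

text \<open>The numbering \<open>\<nu>\<close> is injective, so counting numbers is counting vertices.  This carries the degrees and
  the lengths of the adjacency lists back to the graph.\<close>

lemma encodes_algorithm_correct:
  assumes G: "simple_graph V E" and split: "split_partition V E K I" and enc: "encodes \<nu> s V E K I"
  shows "runs ird_algorithm s (43 * card V + 34 * card E + 34)
    (\<lambda>s'. var s' ''i_R(G)'' = card I - max_deg_I E K I + 2)"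
proof -
  let ?seg = "\<lambda>m. {arr s ''off'' m..<arr s ''off'' (Suc m)}"
  have fin: "finite V" "finite K" "finite I"
    using G split by (auto simp: simple_graph_def split_partition_def)
  have V: "V = K \<union> I" "K \<inter> I = {}"
    using split by (auto simp: split_partition_def)
  have nu: "inj_on \<nu> V" "\<nu> ` V = {0..<card V}"
    using enc by (simp_all add: encodes_def bij_betw_def)
  have nK: "var s ''nK'' = card K" and nI: "var s ''nI'' = card I"
    using enc by (simp_all add: encodes_def)
  have bijK: "bij_betw (arr s ''K'') {..<card K} (\<nu> ` K)"
    using enc by (simp add: encodes_def atLeast0LessThan)
  then have K: "arr s ''K'' ` {..<card K} = \<nu> ` K"
    by (simp add: bij_betw_def)
  have I: "arr s ''I'' ` {..<card I} = \<nu> ` I"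
    using enc by (simp add: encodes_def bij_betw_def atLeast0LessThan)
  have nbr: "bij_betw (arr s ''nbr'') (?seg (\<nu> v)) (\<nu> ` neighbours E v)" if "v \<in> V" for v
    using enc that by (simp add: encodes_def)
  have inj_nbr: "inj_on \<nu> (neighbours E v)" for v
    using nu(1) neighbours_subset[OF G] by (rule inj_on_subset)
  have vertex: "\<exists>v\<in>K. arr s ''K'' j = \<nu> v" if "j < card K" for j
    using K that by blast
  have deg: "(\<Sum>q\<in>?seg (\<nu> v). of_bool (arr s ''nbr'' q \<in> \<nu> ` I)) = card (neighbours E v \<inter> I)"
    if "v \<in> V" for v
  proof -
    have "(\<Sum>q\<in>?seg (\<nu> v). of_bool (arr s ''nbr'' q \<in> \<nu> ` I)) =
        (\<Sum>m\<in>\<nu> ` neighbours E v. of_bool (m \<in> \<nu> ` I) :: nat)"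
      by (rule sum.reindex_bij_betw[OF nbr[OF that]])
    also have "\<dots> = (\<Sum>u\<in>neighbours E v. of_bool (\<nu> u \<in> \<nu> ` I))"
      by (simp add: sum.reindex[OF inj_nbr])
    also have "\<dots> = (\<Sum>u\<in>neighbours E v. of_bool (u \<in> I))"
      by (intro sum.cong refl arg_cong[where f = of_bool] inj_on_image_mem_iff[OF nu(1)])
        (use neighbours_subset[OF G] V in auto)
    also have "\<dots> = card (neighbours E v \<inter> I)"
      using finite_subset[OF neighbours_subset[OF G] fin(1)] by simp
    finally show ?thesis .
  qed
  have "(\<Sum>j<card K. card (?seg (arr s ''K'' j))) = (\<Sum>m\<in>\<nu> ` K. card (?seg m))"
    by (rule sum.reindex_bij_betw[OF bijK])
  also have "\<dots> = (\<Sum>v\<in>K. card (?seg (\<nu> v)))"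
    using inj_on_subset[OF nu(1)] V by (simp add: sum.reindex)
  also have "\<dots> = (\<Sum>v\<in>K. card (neighbours E v))"
    using V by (intro sum.cong refl) (metis UnI1 nbr bij_betw_same_card card_image inj_nbr)
  also have "\<dots> \<le> 2 * card E"
    using V by (intro sum_card_neighbours_le[OF G]) auto
  finally have segs: "(\<Sum>j<card K. card (?seg (arr s ''K'' j))) \<le> 2 * card E" .
  have "(\<lambda>m. \<Sum>q\<in>?seg m. of_bool (arr s ''nbr'' q \<in> \<nu> ` I)) ` \<nu> ` K =
      (\<lambda>x. card (neighbours E x \<inter> I)) ` K"
    unfolding image_image using V deg by (intro image_cong) auto
  then have max: "Max (insert 0 ((\<lambda>m. \<Sum>q\<in>?seg m. of_bool (arr s ''nbr'' q \<in> \<nu> ` I)) ` \<nu> ` K)) =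
      max_deg_I E K I"
    by (simp only: max_deg_I_def)
  show ?thesis
  proof (rule runs_mono, rule runs_ird_algorithm)
    fix j assume "j < var s ''nK''"
    then obtain v where v: "v \<in> K" "arr s ''K'' j = \<nu> v"
      using vertex nK by auto
    then have "v \<in> V" "\<nu> v < card V"
      using V nu(2) by auto
    then show "arr s ''off'' (arr s ''K'' j) \<le> arr s ''off'' (Suc (arr s ''K'' j))"
      using enc v(2) by (simp add: encodes_def)
    show "arr s ''nbr'' ` ?seg (arr s ''K'' j) \<subseteq>
        arr s ''K'' ` {..<var s ''nK''} \<union> arr s ''I'' ` {..<var s ''nI''}"
      unfolding nK nI K I v(2) bij_betw_imp_surj_on[OF nbr[OF \<open>v \<in> V\<close>]]
      using neighbours_subset[OF G, of v] V(1) by auto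
  next
    have "card V = card K + card I"
      using V fin by (simp add: card_Un_disjoint)
    then show "43 * var s ''nK'' + 12 * var s ''nI'' +
        17 * (\<Sum>j<var s ''nK''. card (?seg (arr s ''K'' j))) + 34
      \<le> 43 * card V + 34 * card E + 34"
      unfolding nK nI using segs by linarith
  next
    fix s' :: state
    assume "var s' ''i_R(G)'' = var s ''nI'' -
      Max (insert 0 ((\<lambda>m. \<Sum>q\<in>?seg m. of_bool (arr s ''nbr'' q \<in> arr s ''I'' ` {..<var s ''nI''})) `
        arr s ''K'' ` {..<var s ''nK''})) + 2"
    then show "var s' ''i_R(G)'' = card I - max_deg_I E K I + 2"
      unfolding nK nI K I max .
  qed
qed

theorem theorem3p3:
  "\<exists>c::nat. \<forall>(V::'a set) E K I \<nu> s.
     simple_graph V E \<and> connected_graph V E \<and> card V \<ge> 2 \<and>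
     split_partition V E K I \<and> encodes \<nu> s V E K I \<longrightarrow>
     (\<exists>t s'. exec ird_algorithm s t s' \<and>
             var s' ''i_R(G)'' = ind_roman_dom_number V E \<and>
             t \<le> c * (card V + card E))"
proof (rule exI[of _ 60], intro allI impI, elim conjE)
  fix V :: "'a set" and E K I \<nu> s
  assume G: "simple_graph V E" "connected_graph V E" "card V \<ge> 2"
    and split: "split_partition V E K I" and enc: "encodes \<nu> s V E K I"
  obtain t s' where t: "exec ird_algorithm s t s'" "t \<le> 43 * card V + 34 * card E + 34"
    and s': "var s' ''i_R(G)'' = card I - max_deg_I E K I + 2"
    using encodes_algorithm_correct[OF G(1) split enc] by (auto simp: runs_def)
  \<comment> \<open>The additive constant 34 is at most \<open>17 * card V\<close>, and \<open>43 + 17 = 60\<close>.\<close>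
  have "t \<le> 60 * (card V + card E)"
    using t(2) G(3) by (simp add: algebra_simps)
  then show "\<exists>t s'. exec ird_algorithm s t s' \<and>
      var s' ''i_R(G)'' = ind_roman_dom_number V E \<and> t \<le> 60 * (card V + card E)"
    using t(1) s' ind_roman_dom_number_split_graph[OF G split] by metis
qed

end
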